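(* Let $g,h:\mathbb{R}^m\to\mathbb{R}\cup\{+\infty\}$ and $\phi=g-h$ satisfy the standing assumptions described in the context. Suppose that the sequence $\{x_k\}$ generated by the BDCA (described in the context) has the limit point $x^*$. Assume that $\nabla g$ is locally Lipschitz continuous around $x^*$ and that $\phi$ satisfies the strong Kurdyka–Łojasiewicz inequality at $x^*$ with $\varphi(t)=Mt^{1-\theta}$ for some $M>0$ and $0\le\theta<1$. Then the following convergence rates are guaranteed: (i) if $\theta=0$, then the sequence $\{x_k\}$ converges in a finite number of steps to $x^*$; (ii) if $\theta\in\,]0,\frac12]$, then the sequence $\{x_k\}$ converges linearly to $x^*$; (iii) if $\theta\in\,]\frac12,1[$, then there exists a positive constant $\eta$ such that $$\|x_k-x^*\|\le\eta\,k^{-\frac{1-\theta}{2\theta-1}}$$ for all large $k$.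
   Context: Problem. $\|\cdot\|$ and $\langle\cdot,\cdot\rangle$ are the Euclidean norm and inner product of $\mathbb{R}^m$. We consider $(\mathcal P)$: minimize $\phi(x):=g(x)-h(x)$ over $x\in\mathbb{R}^m$, where $g,h:\mathbb{R}^m\to\mathbb{R}\cup\{+\infty\}$ are proper convex functions, with the conventions $(+\infty)-(+\infty)=+\infty$, $(+\infty)-\lambda=+\infty$ and $\lambda-(+\infty)=-\infty$ for $\lambda\in\,]-\infty,+\infty[$. We write $\operatorname{dom} f=\{x: f(x)<+\infty\}$. The convex subdifferential is $\partial h(\bar x)=\{u\in\mathbb{R}^m: h(x)-h(\bar x)\ge\langle u,x-\bar x\rangle\ \forall x\in\mathbb{R}^m\}$ for $\bar x\in\operatorname{dom}h$, and $\partial h(\bar x)=\emptyset$ otherwise. Standing assumptions. (Assumption 1) Both $g$ and $h$ are strongly convex with modulus $\rho>0$, i.e. $g-\frac{\rho}{2}\|\cdot\|^2$ and $h-\frac{\rho}{2}\|\cdot\|^2$ are convex. (Assumption 2) $\partial h(x)\ne\emptyset$ for all $x\in\operatorname{dom}h$; $g$ is continuously differentiable on an open set containing $\operatorname{dom}h$; and $\inf_{x\in\mathbb{R}^m}\phi(x)>-\infty$. BDCA (Boosted DC Algorithm). Step 1. Fix $\alpha>0$ and $0<\beta<1$. Let $x_0$ be any initial point and set $k:=0$. Step 2. Select $u_k\in\partial h(x_k)$ and solve the strongly convex problem $(\mathcal P_k)$: minimize $g(x)-\langle u_k,x\rangle$ over $x\in\mathbb{R}^m$, to obtain its unique solution $y_k$.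 Step 3. Set $d_k:=y_k-x_k$. If $d_k=0$, stop and return $x_k$. Otherwise go to Step 4. Step 4. Choose any $\overline\lambda_k\ge0$ and set $\lambda_k:=\overline\lambda_k$. While $\phi(y_k+\lambda_kd_k)>\phi(y_k)-\alpha\lambda_k^2\|d_k\|^2$, replace $\lambda_k:=\beta\lambda_k$. Step 5. Set $x_{k+1}:=y_k+\lambda_kd_k$, set $k:=k+1$, and go to Step 2. It is understood that Step 2 can be carried out at each iteration, i.e. $\partial h(x_k)\neq\emptyset$ and $(\mathcal P_k)$ has a (unique) solution $y_k$. Clarke subdifferential. For a locally Lipschitz function $f$, $\partial_Cf(\bar x)=\operatorname{co}\{\lim_{x\to\bar x,\ x\notin\Omega_f}\nabla f(x)\}$, the convex hull of all limits of gradients along sequences converging to $\bar x$ and avoiding the Lebesgue-null set $\Omega_f$ where $f$ fails to be differentiable. Strong Kurdyka–Łojasiewicz inequality. A locally Lipschitz function $f:\mathbb{R}^m\to\mathbb{R}$ satisfies the strong Kurdyka–Łojasiewicz inequality at $x^*\in\mathbb{R}^m$ if there exist $\eta\in\,]0,+\infty[$, a neighborhood $U$ of $x^*$, and a concave function $\varphi:[0,\eta]\to[0,+\infty[$ such that: (i) $\varphi(0)=0$; (ii) $\varphi$ is of class $\mathcal C^1$ on $]0,\eta[$; (iii) $\varphi'>0$ on $]0,\eta[$; (iv) for all $x\in U$ with $f(x^* )<f(x)<f(x^* )+\eta$ we have $\varphi'(f(x)-f(x^* ))\operatorname{dist}(0,\partial_Cf(x))\ge1$. (Thus, assuming this inequality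 for $\phi$ includes that $\phi$ is real-valued and locally Lipschitz.) It is satisfied "with $\varphi(t)=Mt^{1-\theta}$" if the function $\varphi$ in this definition can be taken of that form. Here $\operatorname{dist}(0,S)=\inf_{s\in S}\|s\|$. Convergence terms. "Converges in a finite number of steps to $x^*$" means that $x_k=x^*$ from some index on (possibly because the algorithm stops at $x^*$). "Converges linearly to $x^*$" means that there are $C>0$ and $q\in\,]0,1[$ such that $\|x_k-x^*\|\le Cq^k$ for all large $k$. *)

theory Defs
  imports "HOL-Analysis.Analysis" "HOL-Library.While_Combinator"
begin

section \<open>Extended-real-valued convex functions\<close>

definition edom :: "('a \<Rightarrow> ereal) \<Rightarrow> 'a set" where
  "edom f = {x. f x < \<infinity>}"

definition proper :: "('a \<Rightarrow> ereal) \<Rightarrow> bool" where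
  "proper f \<longleftrightarrow> (\<forall>x. f x \<noteq> -\<infinity>) \<and> edom f \<noteq> {}"

definition econvex :: "('a::real_vector \<Rightarrow> ereal) \<Rightarrow> bool" where
  "econvex f \<longleftrightarrow> (\<forall>x y t. 0 < t \<and> t < 1 \<longrightarrow>
     f ((1 - t) *\<^sub>R x + t *\<^sub>R y) \<le> ereal (1 - t) * f x + ereal t * f y)"

definition strongly_econvex :: "real \<Rightarrow> ('a::real_normed_vector \<Rightarrow> ereal) \<Rightarrow> bool" where
  "strongly_econvex \<rho> f \<longleftrightarrow> econvex (\<lambda>x. f x - ereal (\<rho> / 2 * (norm x)\<^sup>2))"

definition subdifferential :: "('a::real_inner \<Rightarrow> ereal) \<Rightarrow> 'a \<Rightarrow> 'a set" where
  "subdifferential f a =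
     (if a \<in> edom f then {u. \<forall>x. f x - f a \<ge> ereal (u \<bullet> (x - a))} else {})"

(* Subtraction on ereal satisfies \<infinity> - \<infinity> = \<infinity>, \<infinity> - r = \<infinity> and r - \<infinity> = -\<infinity>. *)
definition dc_objective :: "('a \<Rightarrow> ereal) \<Rightarrow> ('a \<Rightarrow> ereal) \<Rightarrow> 'a \<Rightarrow> ereal" where
  "dc_objective g h = (\<lambda>x. g x - h x)"

section \<open>Gradients and local Lipschitz continuity\<close>

(* Only meaningful at points where f is differentiable. *)
definition gradient :: "('a::real_inner \<Rightarrow> real) \<Rightarrow> 'a \<Rightarrow> 'a" where
  "gradient f x = (THE D. GDERIV f x :> D)"

definition finite_C1_on :: "('a::real_inner \<Rightarrow> ereal) \<Rightarrow> 'a set \<Rightarrow> bool" where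
  "finite_C1_on f S \<longleftrightarrow>
     (\<forall>x\<in>S. \<bar>f x\<bar> \<noteq> \<infinity>) \<and>
     (\<forall>x\<in>S. (\<lambda>z. real_of_ereal (f z)) differentiable (at x)) \<and>
     continuous_on S (gradient (\<lambda>z. real_of_ereal (f z)))"

definition lipschitz_around :: "('a::metric_space \<Rightarrow> 'b::metric_space) \<Rightarrow> 'a \<Rightarrow> bool" where
  "lipschitz_around f a \<longleftrightarrow> (\<exists>U L. open U \<and> a \<in> U \<and> L-lipschitz_on U f)"

definition locally_lipschitz :: "('a::metric_space \<Rightarrow> 'b::metric_space) \<Rightarrow> bool" where
  "locally_lipschitz f \<longleftrightarrow> (\<forall>a. lipschitz_around f a)"

section \<open>Clarke subdifferential and the strong Kurdyka-Lojasiewicz inequality\<close>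

definition clarke_subdifferential :: "('a::euclidean_space \<Rightarrow> real) \<Rightarrow> 'a \<Rightarrow> 'a set" where
  "clarke_subdifferential f a =
     convex hull {v. \<exists>s::nat \<Rightarrow> 'a. (\<forall>n. f differentiable (at (s n))) \<and>
                       s \<longlonglongrightarrow> a \<and> (\<lambda>n. gradient f (s n)) \<longlonglongrightarrow> v}"

(* The inequality holds at a with the desingularising function \<psi>.
   The distance from 0 to a set is infdist 0; its value 0 on the empty set plays no role,
   as the Clarke subdifferential of a locally Lipschitz function is nonempty. *)
definition strong_KL_with ::
  "(real \<Rightarrow> real) \<Rightarrow> ('a::euclidean_space \<Rightarrow> real) \<Rightarrow> 'a \<Rightarrow> bool" where
  "strong_KL_with \<psi> f a \<longleftrightarrow>
     locally_lipschitz f \<and>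
     (\<exists>\<eta>>0. \<exists>U. open U \<and> a \<in> U \<and>
        concave_on {0..\<eta>} \<psi> \<and> \<psi> ` {0..\<eta>} \<subseteq> {0..} \<and>
        \<psi> 0 = 0 \<and>
        \<psi> C1_differentiable_on {0<..<\<eta>} \<and>
        (\<forall>t\<in>{0<..<\<eta>}. deriv \<psi> t > 0) \<and>
        (\<forall>x\<in>U. f a < f x \<and> f x < f a + \<eta> \<longrightarrow>
            deriv \<psi> (f x - f a) * infdist 0 (clarke_subdifferential f x) \<ge> 1))"

section \<open>The boosted DC algorithm\<close>

(* One pass through Steps 2-5 from the iterate x: subgradient u, solution y of the convex
   subproblem (its only solution, g being strongly convex), trial step size lb, accepted step
   size l, next iterate x'. If the algorithm stops at x, then x' = x.
   while_option returns Some l iff the backtracking loop terminates with l. *)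
definition bdca_step ::
  "('a::euclidean_space \<Rightarrow> ereal) \<Rightarrow> ('a \<Rightarrow> ereal) \<Rightarrow> real \<Rightarrow> real \<Rightarrow>
   'a \<Rightarrow> 'a \<Rightarrow> 'a \<Rightarrow> real \<Rightarrow> real \<Rightarrow> 'a \<Rightarrow> bool" where
  "bdca_step g h \<alpha> \<beta> x u y lb l x' \<longleftrightarrow>
     u \<in> subdifferential h x \<and>
     is_arg_min (\<lambda>z. g z - ereal (u \<bullet> z)) (\<lambda>_. True) y \<and>
     (let d = y - x; \<phi> = dc_objective g h in
      if d = 0 then x' = x
      else lb \<ge> 0 \<and>
           while_option (\<lambda>t. \<phi> (y + t *\<^sub>R d) > \<phi> y - ereal (\<alpha> * t\<^sup>2 * (norm d)\<^sup>2))
             (\<lambda>t. \<beta> * t) lb = Some l \<and>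
           x' = y + l *\<^sub>R d)"

(* x is the sequence of iterates of a run; if the algorithm stops at x k (that is, y k = x k),
   the sequence is continued by the constant value x k. *)
definition bdca_sequence ::
  "('a::euclidean_space \<Rightarrow> ereal) \<Rightarrow> ('a \<Rightarrow> ereal) \<Rightarrow> real \<Rightarrow> real \<Rightarrow> (nat \<Rightarrow> 'a) \<Rightarrow> bool" where
  "bdca_sequence g h \<alpha> \<beta> x \<longleftrightarrow>
     (\<exists>u y lb l. \<forall>k.
        if \<exists>j<k. y j = x j then x (Suc k) = x k
        else bdca_step g h \<alpha> \<beta> (x k) (u k) (y k) (lb k) (l k) (x (Suc k)))"

end

theory Submission
  imports Defs
begin

text \<open>Finiteness of \<open>\<phi>\<close> forces \<open>g\<close> and \<open>h\<close> to be finite everywhere. Strong convexity of both functions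
  gives \<open>\<phi>(x\<^sub>k) - \<phi>(x\<^sub>k\<^sub>+\<^sub>1) \<ge> (\<rho> + \<alpha> \<lambda>\<^sub>k\<^sup>2) \<parallel>d\<^sub>k\<parallel>\<^sup>2\<close>, which dominates both \<open>\<parallel>d\<^sub>k\<parallel>\<^sup>2\<close> and
  \<open>\<parallel>x\<^sub>k\<^sub>+\<^sub>1 - x\<^sub>k\<parallel> \<parallel>d\<^sub>k\<parallel>\<close>. Since \<open>u\<^sub>k = \<nabla>g(y\<^sub>k)\<close> is a subgradient of \<open>h\<close> at \<open>x\<^sub>k\<close>, the distance from \<open>0\<close> to
  \<open>\<partial>\<^sub>C\<phi>(x\<^sub>k)\<close> is at most \<open>\<parallel>\<nabla>g(x\<^sub>k) - \<nabla>g(y\<^sub>k)\<parallel> \<le> L \<parallel>d\<^sub>k\<parallel>\<close>; this needs that every convex subgradient lies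
  in the closed convex hull of the limits of gradients. The Kurdyka-Lojasiewicz inequality and
  concavity of \<open>t \<mapsto> t\<^sup>1\<^sup>-\<^sup>\<theta>\<close> then bound \<open>\<parallel>x\<^sub>k\<^sub>+\<^sub>1 - x\<^sub>k\<parallel>\<close> by a telescoping difference, and the rates
  follow from the scalar recursion \<open>r\<^sub>k - r\<^sub>k\<^sub>+\<^sub>1 \<ge> c r\<^sub>k\<^sup>2\<^sup>\<theta>\<close> for \<open>r\<^sub>k = \<phi>(x\<^sub>k) - \<phi>(x\<^sup>*)\<close>.\<close>

section \<open>Gradients and subgradients of finite functions\<close>

lemma gradient_eqI:
  assumes "GDERIV f x :> D"
  shows "gradient f x = D"
  unfolding gradient_def
proof (rule the_equality[where P = "\<lambda>D. GDERIV f x :> D", OF assms])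
  fix E assume "GDERIV f x :> E"
  with assms have "(\<lambda>v. v \<bullet> D) = (\<lambda>v. v \<bullet> E)"
    unfolding gderiv_def by (rule has_derivative_unique)
  then have "\<forall>v. v \<bullet> E = v \<bullet> D"
    by (simp add: fun_eq_iff)
  then show "E = D"
    by (rule vector_eq_ldot[THEN iffD1])
qed

lemma differentiable_imp_GDERIV:
  fixes f :: "'a::euclidean_space \<Rightarrow> real"
  assumes "f differentiable (at x)"
  shows "GDERIV f x :> gradient f x"
proof -
  obtain f' where f': "(f has_derivative f') (at x)"
    using assms by (auto simp: differentiable_def)
  then have "linear f'"
    by (rule has_derivative_linear)
  then have "f' = (\<lambda>v. v \<bullet> adjoint f' 1)"
    by (auto simp: adjoint_works)
  with f' have "GDERIV f x :> adjoint f' 1"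
    unfolding gderiv_def by metis
  then show ?thesis
    using gradient_eqI by metis
qed

lemma GDERIV_imp_differentiable: "GDERIV f x :> D \<Longrightarrow> f differentiable (at x)"
  unfolding gderiv_def differentiable_def by blast

text \<open>The convex subdifferential for functions that are finite everywhere, free of the domain
  case; \<open>subdifferential_ereal\<close> ties the two notions together.\<close>

definition subgradients :: "('a::real_inner \<Rightarrow> real) \<Rightarrow> 'a \<Rightarrow> 'a set" where
  "subgradients f a = {u. \<forall>z. f a + u \<bullet> (z - a) \<le> f z}"

lemma subgradientsD: "u \<in> subgradients f a \<Longrightarrow> f a + u \<bullet> (z - a) \<le> f z"
  by (simp add: subgradients_def)

text \<open>\<open>f z - u \<bullet> z\<close> is minimal at \<open>a\<close>, so its derivative
  vanishes there.\<close>

lemma subgradient_eq_gradient: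
  assumes u: "u \<in> subgradients f a" and D: "GDERIV f a :> D"
  shows "u = D"
proof -
  have "((\<lambda>z. f z - u \<bullet> z) has_derivative (\<lambda>v. v \<bullet> D - u \<bullet> v)) (at a)"
    using D unfolding gderiv_def by (auto intro!: derivative_eq_intros)
  moreover have "\<forall>z\<in>UNIV. f a - u \<bullet> a \<le> f z - u \<bullet> z"
    using u by (auto simp: subgradients_def inner_diff_right algebra_simps)
  ultimately have "(\<lambda>v. v \<bullet> D - u \<bullet> v) = (\<lambda>v. 0)"
    using differential_zero_maxmin[of a UNIV "\<lambda>z. f z - u \<bullet> z"] by simp
  then have "(D - u) \<bullet> (D - u) = 0"
    by (metis inner_commute inner_diff_left)
  then show ?thesis
    by simp
qed

text \<open>On the segment from \<open>a\<close> to \<open>z\<close> the squared norm has convexity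
  defect \<open>t * (1 - t) * (norm (z - a))\<^sup>2\<close>. Combining this with the subgradient
  inequality and dividing by \<open>t\<close> leaves a factor \<open>1 - t\<close>, which tends to
  1.\<close>

lemma subgradient_strong:
  fixes f :: "'a::real_inner \<Rightarrow> real"
  assumes conv: "convex_on UNIV (\<lambda>z. f z - \<rho> / 2 * (norm z)\<^sup>2)"
    and u: "u \<in> subgradients f a"
  shows "f a + u \<bullet> (z - a) + \<rho> / 2 * (norm (z - a))\<^sup>2 \<le> f z"
proof -
  let ?R = "\<rho> / 2 * (norm (z - a))\<^sup>2"
  have "u \<bullet> (z - a) + (1 - t) * ?R \<le> f z - f a" if t: "0 < t" "t < 1" for t
  proof -
    define w where "w = (1 - t) *\<^sub>R a + t *\<^sub>R z"
    have "f w - \<rho> / 2 * (norm w)\<^sup>2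
        \<le> (1 - t) * (f a - \<rho> / 2 * (norm a)\<^sup>2) + t * (f z - \<rho> / 2 * (norm z)\<^sup>2)"
      using conv t unfolding convex_on_def w_def by simp
    moreover have "(norm w)\<^sup>2
        = (1 - t) * (norm a)\<^sup>2 + t * (norm z)\<^sup>2 - t * (1 - t) * (norm (z - a))\<^sup>2"
      unfolding power2_norm_eq_inner w_def
      by (simp add: inner_add_left inner_add_right inner_diff_left inner_diff_right
          inner_commute algebra_simps power2_eq_square)
    then have "\<rho> / 2 * (norm w)\<^sup>2 = \<rho> / 2 *
        ((1 - t) * (norm a)\<^sup>2 + t * (norm z)\<^sup>2 - t * (1 - t) * (norm (z - a))\<^sup>2)"
      by simp
    moreover have "w - a = t *\<^sub>R (z - a)"
      by (simp add: w_def algebra_simps)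
    then have "f a + t * (u \<bullet> (z - a)) \<le> f w"
      using subgradientsD[OF u, of w] by simp
    ultimately have "t * (u \<bullet> (z - a) + (1 - t) * ?R) \<le> t * (f z - f a)"
      by (simp add: algebra_simps add_divide_distrib diff_divide_distrib)
    then show ?thesis
      using t by simp
  qed
  then have "\<forall>\<^sub>F t in at_right 0. u \<bullet> (z - a) + (1 - t) * ?R \<le> f z - f a"
    unfolding eventually_at_right_field using zero_less_one by blast
  moreover have "((\<lambda>t. u \<bullet> (z - a) + (1 - t) * ?R) \<longlongrightarrow> u \<bullet> (z - a) + (1 - 0) * ?R) (at_right 0)"
    by (intro tendsto_intros)
  ultimately have "u \<bullet> (z - a) + (1 - 0) * ?R \<le> f z - f a"
    by (intro tendsto_upperbound) auto
  then show ?thesis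
    by simp
qed

text \<open>A maximiser \<open>w\<close> of \<open>f - c * (dist p)\<^sup>2\<close> over a small ball is a point of differentiability:
  near \<open>w\<close> the function lies below a paraboloid, and a subgradient bounds it from below.\<close>

lemma differentiable_near_point:
  fixes f :: "'a::euclidean_space \<Rightarrow> real"
  assumes cont: "continuous_on UNIV f" and sub: "\<And>z. subgradients f z \<noteq> {}" and r: "0 < r"
  obtains w where "dist w p < r" "f differentiable (at w)"
proof -
  have "bounded (f ` cball p r)"
    by (intro compact_imp_bounded compact_continuous_image continuous_on_subset[OF cont]) auto
  then obtain B where B: "\<And>z. z \<in> cball p r \<Longrightarrow> \<bar>f z\<bar> \<le> B"
    unfolding bounded_iff by (metis imageI real_norm_def)
  \<comment> \<open>This makes \<open>c * r\<^sup>2\<close> exceed \<open>2 * B\<close>, a bound on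
    the oscillation of \<open>f\<close> over the ball, so the maximiser \<open>w\<close> cannot lie
    on the boundary.\<close>
  define c where "c = (2 * B + 1) / r\<^sup>2"
  have "0 \<le> B"
    using B[of p] r by force
  then have c: "0 < c"
    using r by (simp add: c_def)
  have "continuous_on (cball p r) (\<lambda>z. f z - c * (norm (z - p))\<^sup>2)"
    by (intro continuous_intros continuous_on_subset[OF cont]) auto
  then obtain w where w: "w \<in> cball p r"
    and max: "\<And>z. z \<in> cball p r \<Longrightarrow> f z - c * (norm (z - p))\<^sup>2 \<le> f w - c * (norm (w - p))\<^sup>2"
    using continuous_attains_sup[of "cball p r" "\<lambda>z. f z - c * (norm (z - p))\<^sup>2"] r by auto
  have "c * (norm (w - p))\<^sup>2 \<le> 2 * B"
    using max[of p] B[of p] B[OF w] r by simp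
  also have "2 * B < c * r\<^sup>2"
    using r by (simp add: c_def)
  finally have "(norm (w - p))\<^sup>2 < r\<^sup>2"
    using c by simp
  then have wr: "dist w p < r"
    using power2_less_imp_less[of "norm (w - p)" r] r by (simp add: dist_norm)
  obtain u where u: "u \<in> subgradients f w"
    using sub by blast
  \<comment> \<open>\<open>a\<close> is the gradient at \<open>w\<close> of the paraboloid
    \<open>c * (norm (z - p))\<^sup>2\<close>; \<open>e\<close> is the radius of a ball about
    \<open>w\<close> that stays inside \<open>cball p r\<close>.\<close>
  define a where "a = (2 * c) *\<^sub>R (w - p)"
  define e where "e = r - dist w p"
  have upper: "f z \<le> f w + a \<bullet> (z - w) + c * (norm (z - w))\<^sup>2" if "dist z w < e" for z
  proof -
    have "z \<in> cball p r"
      using that dist_triangle[of p z w] dist_commute[of p w] dist_commute[of w z]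
      unfolding e_def mem_cball by linarith
    moreover have "c * (norm (z - p))\<^sup>2 - c * (norm (w - p))\<^sup>2
        = a \<bullet> (z - w) + c * (norm (z - w))\<^sup>2"
      unfolding a_def power2_norm_eq_inner
      by (simp add: inner_diff_left inner_diff_right inner_commute algebra_simps)
    ultimately show ?thesis
      using max[of z] by simp
  qed
  have ua: "(u - a) \<bullet> v \<le> c * (norm v)\<^sup>2" if "norm v < e" for v
    using upper[of "w + v"] subgradientsD[OF u, of "w + v"] that
    by (simp add: dist_norm inner_diff_left)
  \<comment> \<open>Otherwise a short step along \<open>u - a\<close> breaks \<open>ua\<close>,
    whose left side is linear and whose right side is quadratic in the step.\<close>
  have "u = a"
  proof (rule ccontr)
    assume "u \<noteq> a"
    then have n: "0 < norm (u - a)"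
      by simp
    define t where "t = min (1 / (2 * c)) (e / (2 * norm (u - a)))"
    have e: "0 < e"
      using wr by (simp add: e_def)
    have "t \<le> 1 / (2 * c)" "t \<le> e / (2 * norm (u - a))"
      by (auto simp: t_def)
    then have "t * c \<le> 1 / 2" "t * norm (u - a) \<le> e / 2"
      using n c by (auto simp: pos_le_divide_eq mult_ac)
    moreover have "0 < t"
      using n c e by (simp add: t_def)
    ultimately have t: "0 < t" "t * c \<le> 1 / 2" "t * norm (u - a) < e"
      using e by auto
    have "t * (norm (u - a))\<^sup>2 = (u - a) \<bullet> (t *\<^sub>R (u - a))"
      by (simp add: power2_norm_eq_inner)
    also have "\<dots> \<le> c * (norm (t *\<^sub>R (u - a)))\<^sup>2"
      using t by (intro ua) simp
    also have "\<dots> = (t * c) * (t * (norm (u - a))\<^sup>2)"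
      by (simp add: power_mult_distrib power2_eq_square)
    also have "\<dots> \<le> 1 / 2 * (t * (norm (u - a))\<^sup>2)"
      using t by (intro mult_right_mono) auto
    finally show False
      using n t by simp
  qed
  have "(f has_derivative (\<lambda>v. u \<bullet> v)) (at w)"
  proof (rule has_derivativeI_sandwich)
    show "0 < e"
      using wr by (simp add: e_def)
    show "bounded_linear (\<lambda>v. u \<bullet> v)"
      by (rule bounded_linear_inner_right)
    fix z assume z: "z \<noteq> w" "dist z w < e"
    have "norm ((f z - f w) - u \<bullet> (z - w)) \<le> c * (norm (z - w))\<^sup>2"
      using upper[OF z(2)] subgradientsD[OF u, of z] \<open>u = a\<close> by simp
    then show "norm ((f z - f w) - u \<bullet> (z - w)) / norm (z - w) \<le> c * norm (z - w)"
      using z by (simp add: divide_simps power2_eq_square mult.assoc)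
  next
    have "((\<lambda>z. c * norm (z - w)) \<longlongrightarrow> c * norm (w - w)) (at w)"
      by (intro tendsto_intros)
    then show "((\<lambda>z. c * norm (z - w)) \<longlongrightarrow> 0) (at w)"
      by simp
  qed
  then have "f differentiable (at w)"
    unfolding differentiable_def by blast
  with wr show ?thesis
    by (rule that)
qed

text \<open>A unit step from \<open>w\<close> along \<open>q\<close> raises \<open>f\<close> by at
  least \<open>norm q\<close>, and both ends stay in the ball where \<open>f\<close> is
  bounded.\<close>

lemma norm_subgradient_le:
  assumes q: "q \<in> subgradients f w" and w: "dist w a \<le> 1"
    and B: "\<And>z. z \<in> cball a 2 \<Longrightarrow> \<bar>f z\<bar> \<le> B"
  shows "norm q \<le> 2 * B"
proof -
  have "dist (w + sgn q) a \<le> dist w a + norm (sgn q)"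
    by (metis add.commute add_diff_eq dist_norm norm_triangle_ineq)
  then have "w + sgn q \<in> cball a 2" "w \<in> cball a 2"
    using w by (auto simp: dist_commute norm_sgn split: if_splits)
  moreover have "q \<bullet> sgn q = norm q"
    by (cases "q = 0") (simp_all add: sgn_div_norm power2_norm_eq_inner[symmetric] power2_eq_square)
  ultimately show ?thesis
    using B[of w] B[of "w + sgn q"] subgradientsD[OF q, of "w + sgn q"] by auto
qed

section \<open>Convex subgradients and the Clarke subdifferential\<close>

text \<open>If the subgradient \<open>u\<close> were separated from the limiting gradients of \<open>H\<close> by a direction \<open>v\<close>,
  then gradients of \<open>H\<close> at points approaching \<open>a\<close> in the direction \<open>v\<close> would contradict the
  monotonicity of the subdifferential.\<close>

lemma subgradient_diff_in_closure_clarke: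
  fixes G H :: "'a::euclidean_space \<Rightarrow> real"
  assumes G: "\<And>z. G differentiable (at z)" and contG: "isCont (gradient G) a"
    and contH: "continuous_on UNIV H" and sub: "\<And>z. subgradients H z \<noteq> {}"
    and u: "u \<in> subgradients H a"
  shows "gradient G a - u \<in> closure (clarke_subdifferential (\<lambda>z. G z - H z) a)"
    (is "_ \<in> closure ?C")
proof (rule ccontr)
  assume "gradient G a - u \<notin> closure ?C"
  moreover have "convex (closure ?C)"
    unfolding clarke_subdifferential_def by (intro convex_closure convex_convex_hull)
  ultimately obtain v b where sep: "v \<bullet> (gradient G a - u) < b" "\<And>c. c \<in> closure ?C \<Longrightarrow> b < v \<bullet> c"
    using separating_hyperplane_closed_point[of "closure ?C" "gradient G a - u"] by auto
  \<comment> \<open>The scaling keeps the points \<open>w n\<close> chosen below within distance 1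
    of \<open>a\<close>, as \<open>norm_subgradient_le\<close> demands; the added 1 covers
    \<open>v = 0\<close> and the error \<open>(t n)\<^sup>2\<close>.\<close>
  define t where "t n = inverse (real (Suc n)) / (norm v + 1)" for n
  have nv: "0 < norm v + 1"
    by (simp add: add_nonneg_pos)
  then have t: "0 < t n" for n
    by (simp add: t_def)
  have "t n * (norm v + 1) = inverse (real (Suc n))" for n
    using nv by (simp add: t_def del: of_nat_Suc)
  then have tv: "t n * (norm v + 1) \<le> 1" for n
    by (simp add: inverse_le_1_iff)
  have "t n * 1 \<le> t n * (norm v + 1)" for n
    using t[of n] by (intro mult_left_mono) auto
  then have t1: "t n \<le> 1" for n
    using tv[of n] by (metis mult.right_neutral order_trans)
  have "t \<longlonglongrightarrow> 0 / (norm v + 1)"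
    unfolding t_def using nv by (intro tendsto_divide LIMSEQ_inverse_real_of_nat tendsto_const) auto
  then have tlim: "t \<longlonglongrightarrow> 0"
    by simp
  \<comment> \<open>The error is of second order in \<open>t n\<close>, so the difference quotients
    \<open>e n\<close> below still tend to \<open>v\<close>.\<close>
  have "\<exists>w. dist w (a + t n *\<^sub>R v) < (t n)\<^sup>2 \<and> H differentiable (at w)" for n
    using differentiable_near_point[OF contH sub, of "(t n)\<^sup>2" "a + t n *\<^sub>R v"] t[of n]
    by (metis zero_less_power)
  then obtain w where w: "\<And>n. dist (w n) (a + t n *\<^sub>R v) < (t n)\<^sup>2"
    and diffH: "\<And>n. H differentiable (at (w n))"
    by metis
  define q where "q n = gradient H (w n)" for n
  have q: "q n \<in> subgradients H (w n)" for n
    using sub[of "w n"] subgradient_eq_gradient differentiable_imp_GDERIV[OF diffH[of n]]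
    unfolding q_def by blast
  have wa: "dist (w n) a \<le> t n * (norm v + 1)" for n
  proof -
    have "dist (w n) a \<le> dist (w n) (a + t n *\<^sub>R v) + dist (a + t n *\<^sub>R v) a"
      by (rule dist_triangle)
    also have "dist (a + t n *\<^sub>R v) a = t n * norm v"
      using t[of n] by (simp add: dist_norm)
    also have "dist (w n) (a + t n *\<^sub>R v) \<le> t n * 1"
    proof -
      have "(t n)\<^sup>2 \<le> t n * 1"
        unfolding power2_eq_square using t[of n] t1[of n] by (intro mult_left_mono) auto
      then show ?thesis
        using w[of n] by simp
    qed
    finally show ?thesis
      by (simp add: algebra_simps)
  qed
  have "(\<lambda>n. dist (w n) a) \<longlonglongrightarrow> 0"
  proof (rule tendsto_sandwich[OF _ _ tendsto_const])
    show "(\<lambda>n. t n * (norm v + 1)) \<longlonglongrightarrow> 0"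
      using tendsto_mult[OF tlim tendsto_const, of "norm v + 1"] by simp
  qed (use wa in auto)
  then have wlim: "w \<longlonglongrightarrow> a"
    by (rule tendsto_dist_iff[THEN iffD2])
  define e where "e n = (w n - a) /\<^sub>R t n" for n
  have "(\<lambda>n. dist (e n) v) \<longlonglongrightarrow> 0"
  proof (rule tendsto_sandwich[OF _ _ tendsto_const tlim])
    have "dist (e n) v \<le> t n" for n
    proof -
      have "e n - v = (w n - (a + t n *\<^sub>R v)) /\<^sub>R t n"
        using t[of n] by (simp add: e_def algebra_simps)
      then have "dist (e n) v = dist (w n) (a + t n *\<^sub>R v) / t n"
        using t[of n] by (simp add: dist_norm divide_inverse)
      also have "\<dots> \<le> (t n)\<^sup>2 / t n"
        using w[of n] t[of n] by (intro divide_right_mono) auto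
      finally show ?thesis
        by (simp add: power2_eq_square)
    qed
    then show "\<forall>\<^sub>F n in sequentially. dist (e n) v \<le> t n"
      by simp
  qed auto
  then have elim: "e \<longlonglongrightarrow> v"
    by (rule tendsto_dist_iff[THEN iffD2])
  have "bounded (H ` cball a 2)"
    by (intro compact_imp_bounded compact_continuous_image continuous_on_subset[OF contH]) auto
  then obtain B where B: "\<And>z. z \<in> cball a 2 \<Longrightarrow> \<bar>H z\<bar> \<le> B"
    unfolding bounded_iff by (metis imageI real_norm_def)
  have "norm (q n) \<le> 2 * B" for n
    using norm_subgradient_le[OF q _ B] wa[of n] tv[of n] by (metis order_trans)
  then have "\<forall>n. q n \<in> cball 0 (2 * B)"
    by simp
  then obtain \<sigma> s where s: "strict_mono s" and qlim: "(q \<circ> s) \<longlonglongrightarrow> \<sigma>"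
    using compact_cball[of 0 "2 * B"] unfolding compact_def by blast
  have "gradient G a - \<sigma> \<in> ?C"
  proof -
    have grad: "GDERIV (\<lambda>z. G z - H z) (w n) :> gradient G (w n) - q n" for n
      unfolding q_def by (intro GDERIV_diff differentiable_imp_GDERIV G diffH)
    have "(\<lambda>n. gradient G ((w \<circ> s) n) - (q \<circ> s) n) \<longlonglongrightarrow> gradient G a - \<sigma>"
      by (intro tendsto_diff qlim isCont_tendsto_compose[OF contG] LIMSEQ_subseq_LIMSEQ[OF wlim s])
    then have "(\<lambda>n. gradient (\<lambda>z. G z - H z) ((w \<circ> s) n)) \<longlonglongrightarrow> gradient G a - \<sigma>"
      using gradient_eqI[OF grad] by simp
    moreover have "(\<lambda>z. G z - H z) differentiable (at ((w \<circ> s) n))" for n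
      using GDERIV_imp_differentiable[OF grad] by simp
    ultimately show ?thesis
      unfolding clarke_subdifferential_def
      using LIMSEQ_subseq_LIMSEQ[OF wlim s] by (intro hull_inc) blast
  qed
  then have "b < v \<bullet> (gradient G a - \<sigma>)"
    using sep(2) closure_subset by blast
  then have "v \<bullet> \<sigma> < v \<bullet> u"
    using sep(1) by (simp add: inner_diff_right)
  \<comment> \<open>Monotonicity of the subdifferential of \<open>H\<close> between \<open>a\<close>
    and \<open>w n\<close>; its limit contradicts the separation.\<close>
  moreover have "u \<bullet> e n \<le> q n \<bullet> e n" for n
  proof -
    have "u \<bullet> (w n - a) \<le> q n \<bullet> (w n - a)"
      using subgradientsD[OF u, of "w n"] subgradientsD[OF q, of n a]
      by (simp add: inner_diff_right)
    then show ?thesis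
      using t[of n] by (simp add: e_def)
  qed
  then have "u \<bullet> v \<le> \<sigma> \<bullet> v"
    by (intro LIMSEQ_le[of "\<lambda>n. u \<bullet> (e \<circ> s) n" _ "\<lambda>n. (q \<circ> s) n \<bullet> (e \<circ> s) n"]
        tendsto_inner tendsto_const qlim LIMSEQ_subseq_LIMSEQ[OF elim s]) auto
  ultimately show False
    by (simp add: inner_commute)
qed

text \<open>A set and its closure are equally far from 0. Nonemptiness has to be checked because
  \<open>infdist\<close> to the empty set is 0 by convention.\<close>

lemma infdist_clarke_le:
  fixes G H :: "'a::euclidean_space \<Rightarrow> real"
  assumes "\<And>z. G differentiable (at z)" and "isCont (gradient G) a"
    and "continuous_on UNIV H" and "\<And>z. subgradients H z \<noteq> {}"
    and "u \<in> subgradients H a"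
  shows "infdist 0 (clarke_subdifferential (\<lambda>z. G z - H z) a) \<le> norm (gradient G a - u)"
    (is "infdist 0 ?C \<le> _")
proof -
  have cl: "gradient G a - u \<in> closure ?C"
    using assms by (rule subgradient_diff_in_closure_clarke)
  then have "?C \<noteq> {}"
    by auto
  with cl have "infdist (gradient G a - u) ?C = 0"
    using in_closure_iff_infdist_zero by blast
  then show ?thesis
    using infdist_triangle[of 0 ?C "gradient G a - u"] by simp
qed

section \<open>Convergence rates from descent and the Kurdyka-Lojasiewicz inequality\<close>

text \<open>\<open>q\<close> is \<open>t powr (a - 1)\<close> at a mean value point, and
  \<open>a \<le> 1\<close> makes this power antitone. The sign of \<open>a\<close> stays open, since
  both \<open>1 - \<theta>\<close> and a negative exponent are used later.\<close>

lemma powr_diff_mvt: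
  fixes s r a :: real
  assumes "0 < s" "s \<le> r" "a \<le> 1"
  obtains q where "r powr (a - 1) \<le> q" "r powr a - s powr a = a * q * (r - s)"
proof (cases "s = r")
  case True
  then show ?thesis using that[of "r powr (a - 1)"] by simp
next
  case False
  have "((\<lambda>t. t powr a) has_real_derivative a * t powr (a - 1)) (at t)" if "s \<le> t" "t \<le> r" for t
    using assms that by (auto intro!: derivative_eq_intros)
  then obtain t where t: "s < t" "t < r" "r powr a - s powr a = (r - s) * (a * t powr (a - 1))"
    using MVT2[of s r "\<lambda>t. t powr a" "\<lambda>t. a * t powr (a - 1)"] False assms by auto
  have "r powr (a - 1) \<le> t powr (a - 1)"
    using t assms by (intro powr_mono2') auto
  then show ?thesis
    using that t by (simp add: mult_ac)
qed

lemma powr_descent_theta_zero: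
  fixes r :: "nat \<Rightarrow> real"
  assumes "r \<longlonglongrightarrow> 0" "0 < c" "\<And>k. K \<le> k \<Longrightarrow> c \<le> r k - r (Suc k)"
  shows False
proof -
  have "(\<lambda>k. r k - r (Suc k)) \<longlonglongrightarrow> 0 - 0"
    using assms(1) LIMSEQ_Suc[OF assms(1)] by (intro tendsto_intros)
  then have "c \<le> 0 - 0"
  proof (rule LIMSEQ_le_const)
    show "\<exists>N. \<forall>k\<ge>N. c \<le> r k - r (Suc k)"
      using assms(3) by blast
  qed
  then show False using assms(2) by simp
qed

text \<open>Once \<open>r k < 1\<close>, the exponent \<open>2 * \<theta> \<le> 1\<close> makes
  \<open>r k powr (2 * \<theta>)\<close> at least \<open>r k\<close>, so each step contracts by
  \<open>1 - c\<close>.\<close>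

lemma powr_descent_linear:
  fixes r :: "nat \<Rightarrow> real"
  assumes pos: "\<And>k. 0 < r k" and lim: "r \<longlonglongrightarrow> 0"
    and c: "0 < c" and \<theta>: "\<theta> \<le> 1 / 2"
    and desc: "\<And>k. K \<le> k \<Longrightarrow> c * r k powr (2 * \<theta>) \<le> r k - r (Suc k)"
  obtains C q where "0 < C" "0 < q" "q < 1" "\<forall>\<^sub>F k in sequentially. r k \<le> C * q ^ k"
proof -
  obtain N0 where N0: "\<And>k. N0 \<le> k \<Longrightarrow> r k < 1"
    using order_tendstoD(2)[OF lim, of 1] by (auto simp: eventually_sequentially)
  define N where "N = max K N0"
  \<comment> \<open>The maximum keeps the ratio positive even if \<open>c \<ge> 1\<close>.\<close>
  define q where "q = max (1 - c) (1 / 2)"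
  have q: "0 < q" "q < 1"
    using c by (auto simp: q_def)
  have step: "r (Suc k) \<le> q * r k" if "N \<le> k" for k
  proof -
    have "r k powr 1 \<le> r k powr (2 * \<theta>)"
      using pos[of k] N0[of k] that \<theta> by (intro powr_mono') (auto simp: N_def)
    then have "c * r k \<le> r k - r (Suc k)"
      using desc[of k] that pos[of k] c by (smt (verit) N_def max.boundedE mult_left_mono powr_one)
    moreover have "(1 - c) * r k \<le> q * r k"
      using pos[of k] by (intro mult_right_mono) (auto simp: q_def)
    ultimately show ?thesis
      by (simp add: algebra_simps)
  qed
  have "r (N + n) \<le> r N * q ^ n" for n
  proof (induction n)
    case (Suc n)
    have "r (N + Suc n) \<le> q * r (N + n)"
      using step[of "N + n"] by simp
    also have "\<dots> \<le> q * (r N * q ^ n)"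
      using Suc q by simp
    finally show ?case
      by (simp add: mult_ac)
  qed simp
  then have "r k \<le> r N / q ^ N * q ^ k" if "N \<le> k" for k
    using q that le_Suc_ex[OF that] by (auto simp: power_add)
  then show ?thesis
    using that[of "r N / q ^ N" q] q pos[of N] by (auto simp: eventually_sequentially)
qed

text \<open>A discrete form of the equation \<open>r' = - c * r powr (2 * \<theta>)\<close>: with
  \<open>p = 2 * \<theta> - 1\<close>, the power \<open>r k powr (- p)\<close> grows by at least
  \<open>p * c\<close> per step, hence at least linearly in \<open>k\<close>.\<close>

lemma powr_descent_sublinear:
  fixes r :: "nat \<Rightarrow> real"
  assumes pos: "\<And>k. 0 < r k"
    and c: "0 < c" and \<theta>: "1 / 2 < \<theta>"
    and desc: "\<And>k. K \<le> k \<Longrightarrow> c * r k powr (2 * \<theta>) \<le> r k - r (Suc k)"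
  obtains C where "0 < C" "\<forall>\<^sub>F k in sequentially. r k \<le> C * real k powr (- 1 / (2 * \<theta> - 1))"
proof -
  define p where "p = 2 * \<theta> - 1"
  have p: "0 < p"
    using \<theta> by (simp add: p_def)
  have step: "r k powr (- p) + p * c \<le> r (Suc k) powr (- p)" if k: "K \<le> k" for k
  proof -
    have le: "r (Suc k) \<le> r k"
      using desc[OF k] c pos[of k] by (smt (verit) mult_nonneg_nonneg powr_ge_zero)
    obtain q where q: "r k powr (- p - 1) \<le> q"
        "r k powr (- p) - r (Suc k) powr (- p) = - p * q * (r k - r (Suc k))"
      using powr_diff_mvt[OF pos le, of "- p"] p by auto
    have "c = r k powr (- p - 1) * (c * r k powr (2 * \<theta>))"
      using pos[of k] by (simp add: p_def powr_add[symmetric])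
    also have "\<dots> \<le> q * (r k - r (Suc k))"
      using q(1) desc[OF k] c order_trans[OF powr_ge_zero q(1)] by (intro mult_mono) auto
    finally have "p * c \<le> p * (q * (r k - r (Suc k)))"
      using p by simp
    then show ?thesis
      using q(2) by (simp add: mult.assoc)
  qed
  have lower: "real n * (p * c) \<le> r (K + n) powr (- p)" for n
  proof (induction n)
    case (Suc n)
    then show ?case
      using step[of "K + n"] by (simp add: algebra_simps)
  qed simp
  define C where "C = (p * c / 2) powr (- 1 / p)"
  \<comment> \<open>From here on \<open>k - K\<close> is at least \<open>k / 2\<close>, which
    absorbs the shift by \<open>K\<close>; the added 1 keeps \<open>real k\<close> positive.\<close>
  have "r k \<le> C * real k powr (- 1 / p)" if k: "2 * K + 1 \<le> k" for k
  proof -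
    have "real k / 2 \<le> real (k - K)"
      using k by linarith
    then have "p * c / 2 * real k \<le> real (k - K) * (p * c)"
      using mult_right_mono[of "real k / 2" "real (k - K)" "p * c"] p c by (simp add: mult_ac)
    also have "\<dots> \<le> r k powr (- p)"
      using lower[of "k - K"] k by simp
    finally have "(r k powr (- p)) powr (- 1 / p) \<le> (p * c / 2 * real k) powr (- 1 / p)"
      using p c k by (intro powr_mono2') auto
    moreover have "(r k powr (- p)) powr (- 1 / p) = r k"
      using p pos[of k] by (simp add: powr_powr)
    ultimately show ?thesis
      unfolding C_def powr_mult by simp
  qed
  moreover have "0 < C"
    using p c by (simp add: C_def)
  ultimately show ?thesis
    using that[of C] unfolding p_def eventually_sequentially by blast
qed

text \<open>The potential \<open>p\<close> pays for every step taken inside the ball, so an orbit that starts close to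
  the centre with little potential left can never leave the ball.\<close>

lemma finite_length_trapping:
  fixes x :: "nat \<Rightarrow> 'a::metric_space" and p :: "nat \<Rightarrow> real"
  assumes step: "\<And>k. K \<le> k \<Longrightarrow> dist (x k) a < \<delta> \<Longrightarrow> dist (x (Suc k)) (x k) \<le> p k - p (Suc k)"
    and p: "\<And>k. 0 \<le> p k"
    and start: "dist (x K) a + p K < \<delta>"
    and limpt: "strict_mono s" "(x \<circ> s) \<longlonglongrightarrow> a"
    and k: "K \<le> k"
  shows "dist (x k) a < \<delta>" and "dist (x k) a \<le> p k"
proof -
  have stay: "dist (x (K + n)) (x K) \<le> p K - p (K + n)" for n
  proof (induction n)
    case (Suc n)
    have "dist (x (K + n)) a < \<delta>"
      using Suc start p[of "K + n"] dist_triangle[of "x (K + n)" a "x K"] by linarith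
    then have "dist (x (Suc (K + n))) (x (K + n)) \<le> p (K + n) - p (Suc (K + n))"
      by (intro step) auto
    then show ?case
      using Suc dist_triangle[of "x (Suc (K + n))" "x K" "x (K + n)"] by simp
  qed simp
  have inside: "dist (x n) a < \<delta>" if "K \<le> n" for n
    using stay[of "n - K"] that start p[of n] dist_triangle[of "x n" a "x K"] by auto
  then show "dist (x k) a < \<delta>"
    using k .
  \<comment> \<open>All iterates are now known to stay inside, so the telescoping can restart at
    \<open>k\<close>; sending the far end to \<open>a\<close> along the subsequence gives the second
    claim.\<close>
  have tail: "dist (x (k + n)) (x k) \<le> p k - p (k + n)" for n
  proof (induction n)
    case (Suc n)
    have "dist (x (Suc (k + n))) (x (k + n)) \<le> p (k + n) - p (Suc (k + n))"
      using k inside[of "k + n"] by (intro step) auto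
    then show ?case
      using Suc dist_triangle[of "x (Suc (k + n))" "x k" "x (k + n)"] by simp
  qed simp
  have "dist (x k) (x n) \<le> p k" if "k \<le> n" for n
    using tail[of "n - k"] p[of n] that by (simp add: dist_commute)
  then have "\<forall>\<^sub>F n in sequentially. dist (x k) ((x \<circ> s) n) \<le> p k"
    using seq_suble[OF limpt(1)] unfolding eventually_sequentially comp_def by (meson order_trans)
  moreover have "(\<lambda>n. dist (x k) ((x \<circ> s) n)) \<longlonglongrightarrow> dist (x k) a"
    using limpt(2) by (intro tendsto_intros)
  ultimately show "dist (x k) a \<le> p k"
    by (intro tendsto_upperbound) auto
qed

text \<open>\<open>D k\<close> plays the role of the length of the DC direction \<open>d\<^sub>k\<close>.\<close>

lemma kl_descent_rates:
  fixes x :: "nat \<Rightarrow> 'a::real_normed_vector" and f :: "'a \<Rightarrow> real" and D :: "nat \<Rightarrow> real"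
  assumes cont: "isCont f a"
    and \<kappa>: "0 < \<kappa>" and \<rho>: "0 < \<rho>" and D: "\<And>k. 0 \<le> D k"
    and step: "\<And>k. \<kappa> * (dist (x (Suc k)) (x k) * D k) \<le> f (x k) - f (x (Suc k))"
    and desc: "\<And>k. \<rho> * (D k)\<^sup>2 \<le> f (x k) - f (x (Suc k))"
    and stop: "\<And>k j. D k = 0 \<Longrightarrow> k \<le> j \<Longrightarrow> x j = x k"
    and limpt: "strict_mono s" "(x \<circ> s) \<longlonglongrightarrow> a"
    and \<theta>: "0 \<le> \<theta>" "\<theta> < 1" and pos: "0 < \<delta>" "0 < \<eta>" "0 < N"
    and KL: "\<And>k. dist (x k) a < \<delta> \<Longrightarrow> 0 < D k \<Longrightarrow> D k < \<delta> \<Longrightarrow> f a < f (x k) \<Longrightarrow> f (x k) < f a + \<eta> \<Longrightarrow>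
       1 \<le> N * (f (x k) - f a) powr (- \<theta>) * D k"
  shows "\<theta> = 0 \<Longrightarrow> \<forall>\<^sub>F k in sequentially. x k = a"
    and "0 < \<theta> \<Longrightarrow> \<theta> \<le> 1 / 2 \<Longrightarrow> \<exists>C>0. \<exists>q. 0 < q \<and> q < 1 \<and>
           (\<forall>\<^sub>F k in sequentially. norm (x k - a) \<le> C * q ^ k)"
    and "1 / 2 < \<theta> \<Longrightarrow> \<exists>C>0. \<forall>\<^sub>F k in sequentially.
           norm (x k - a) \<le> C * real k powr (- ((1 - \<theta>) / (2 * \<theta> - 1)))"
proof -
  define r where "r k = f (x k) - f a" for k
  have decr: "r (Suc k) \<le> r k" for k
    using desc[of k] \<rho> D[of k] unfolding r_def
    by (smt (verit) mult_nonneg_nonneg zero_le_power2)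
  then have dec: "decseq r"
    by (simp add: decseq_Suc_iff)
  \<comment> \<open>Continuity yields the limit only along the subsequence; monotonicity of
    \<open>r\<close> then makes every \<open>r k\<close> nonnegative and carries the limit to the
    whole sequence.\<close>
  have sub: "(r \<circ> s) \<longlonglongrightarrow> 0"
    using isCont_tendsto_compose[OF cont limpt(2)] unfolding r_def comp_def by (simp add: LIM_zero)
  have r0: "0 \<le> r k" for k
  proof (rule LIMSEQ_le_const2[OF sub])
    show "\<exists>n0. \<forall>n\<ge>n0. (r \<circ> s) n \<le> r k"
      using seq_suble[OF limpt(1)] decseqD[OF dec] unfolding comp_def by (meson order_trans)
  qed
  obtain r' where r': "r \<longlonglongrightarrow> r'"
    using decseq_convergent[OF dec] r0 by blast
  have rlim: "r \<longlonglongrightarrow> 0"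
    using LIMSEQ_unique[OF LIMSEQ_subseq_LIMSEQ[OF r' limpt(1)] sub] r' by simp
  have "(\<theta> = 0 \<longrightarrow> (\<forall>\<^sub>F k in sequentially. x k = a)) \<and>
    (0 < \<theta> \<and> \<theta> \<le> 1 / 2 \<longrightarrow> (\<exists>C>0. \<exists>q. 0 < q \<and> q < 1 \<and>
           (\<forall>\<^sub>F k in sequentially. norm (x k - a) \<le> C * q ^ k))) \<and>
    (1 / 2 < \<theta> \<longrightarrow> (\<exists>C>0. \<forall>\<^sub>F k in sequentially.
           norm (x k - a) \<le> C * real k powr (- ((1 - \<theta>) / (2 * \<theta> - 1)))))"
  proof (cases "\<exists>k. D k = 0")
    \<comment> \<open>The orbit is constant from \<open>K\<close> on, so the constant is the limit
      point and all three rates are trivial.\<close>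
    case True
    then obtain K where K: "D K = 0"
      by blast
    have "(x \<circ> s) \<longlonglongrightarrow> x K"
    proof (rule tendsto_eventually)
      show "\<forall>\<^sub>F n in sequentially. (x \<circ> s) n = x K"
        unfolding eventually_sequentially comp_def
        using stop[OF K] seq_suble[OF limpt(1)] by (meson order_trans)
    qed
    then have "x K = a"
      using limpt(2) LIMSEQ_unique by blast
    then have ev: "\<forall>\<^sub>F k in sequentially. x k = a"
      using stop[OF K] unfolding eventually_sequentially by metis
    have "\<forall>\<^sub>F k in sequentially. norm (x k - a) \<le> 1 * (1 / 2) ^ k"
      using ev by eventually_elim simp
    then have "\<exists>C>0. \<exists>q. 0 < q \<and> q < 1 \<and>
           (\<forall>\<^sub>F k in sequentially. norm (x k - a) \<le> C * q ^ k)"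
      by (intro exI[of _ 1] conjI exI[of _ "1 / 2"]) auto
    moreover have "\<forall>\<^sub>F k in sequentially.
        norm (x k - a) \<le> 1 * real k powr (- ((1 - \<theta>) / (2 * \<theta> - 1)))"
      using ev by eventually_elim simp
    ultimately show ?thesis
      using ev zero_less_one by blast
  next
    case False
    then have Dpos: "0 < D k" for k
      using D[of k] by (metis less_eq_real_def)
    have rpos: "0 < r k" for k
    proof -
      have "0 < \<rho> * (D k)\<^sup>2"
        using \<rho> Dpos[of k] by simp
      then show ?thesis
        using desc[of k] r0[of "Suc k"] by (simp add: r_def)
    qed
    \<comment> \<open>\<open>N\<close> comes from \<open>KL\<close>, \<open>\<kappa>\<close> from
      \<open>step\<close> and \<open>1 - \<theta>\<close> from the mean value theorem; with this
      \<open>A\<close> the decrease of \<open>p\<close> dominates the step length.\<close>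
    define A where "A = N / (\<kappa> * (1 - \<theta>))"
    have A: "0 < A"
      using pos \<kappa> \<theta> by (simp add: A_def)
    define p where "p k = A * r k powr (1 - \<theta>)" for k
    have "(\<lambda>k. r k powr (1 - \<theta>)) \<longlonglongrightarrow> 0"
      using \<theta> r0 by (intro tendsto_zero_powrI[OF rlim tendsto_const]) auto
    then have "p \<longlonglongrightarrow> A * 0"
      unfolding p_def by (intro tendsto_mult tendsto_const)
    then have plim: "p \<longlonglongrightarrow> 0"
      by simp
    have "(\<lambda>k. r k - r (Suc k)) \<longlonglongrightarrow> 0 - 0"
      using rlim LIMSEQ_Suc[OF rlim] by (intro tendsto_diff)
    \<comment> \<open>Through \<open>desc\<close> this threshold becomes
      \<open>D k < \<delta>\<close>, a premise of \<open>KL\<close>.\<close>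
    then have "\<forall>\<^sub>F k in sequentially. r k - r (Suc k) < \<rho> * \<delta>\<^sup>2"
      using pos \<rho> by (intro order_tendstoD(2)[of _ 0]) auto
    moreover have "\<forall>\<^sub>F k in sequentially. r k < \<eta>"
      using order_tendstoD(2)[OF rlim] pos by blast
    moreover have "\<forall>\<^sub>F k in sequentially. p k < \<delta> / 2"
      using pos by (intro order_tendstoD(2)[OF plim]) auto
    ultimately have "\<forall>\<^sub>F k in sequentially. D k < \<delta> \<and> r k < \<eta> \<and> p k < \<delta> / 2"
    proof eventually_elim
      case (elim k)
      have "\<rho> * (D k)\<^sup>2 < \<rho> * \<delta>\<^sup>2"
        using desc[of k] elim by (simp add: r_def)
      then have "(D k)\<^sup>2 < \<delta>\<^sup>2"
        using \<rho> by simp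
      then have "D k < \<delta>"
        by (rule power2_less_imp_less) (use pos in simp)
      then show ?case
        using elim by simp
    qed
    then obtain K0 where K0: "\<And>k. K0 \<le> k \<Longrightarrow> D k < \<delta> \<and> r k < \<eta> \<and> p k < \<delta> / 2"
      unfolding eventually_sequentially by blast
    have KL': "1 \<le> N * r k powr (- \<theta>) * D k" if "K0 \<le> k" "dist (x k) a < \<delta>" for k
      using KL[of k] K0[of k] that rpos[of k] Dpos[of k] by (simp add: r_def)
    have "\<forall>\<^sub>F n in sequentially. dist ((x \<circ> s) n) a < \<delta> / 2"
      by (rule tendstoD[OF limpt(2)]) (use pos in simp)
    then obtain n0 where n0: "\<And>n. n0 \<le> n \<Longrightarrow> dist ((x \<circ> s) n) a < \<delta> / 2"
      unfolding eventually_sequentially by blast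
    \<comment> \<open>An index of the subsequence, so that \<open>x K\<close> is near
      \<open>a\<close>; half of \<open>\<delta>\<close> is spent on the distance and half on the
      potential.\<close>
    define K where "K = s (max K0 n0)"
    have K: "K0 \<le> K" "dist (x K) a < \<delta> / 2"
      using n0[of "max K0 n0"] seq_suble[OF limpt(1), of "max K0 n0"] by (auto simp: K_def)
    have pstep: "dist (x (Suc k)) (x k) \<le> p k - p (Suc k)"
      if k: "K \<le> k" and near: "dist (x k) a < \<delta>" for k
    proof -
      obtain q where q: "r k powr (1 - \<theta> - 1) \<le> q"
          "r k powr (1 - \<theta>) - r (Suc k) powr (1 - \<theta>) = (1 - \<theta>) * q * (r k - r (Suc k))"
        using powr_diff_mvt[OF rpos decr, of "1 - \<theta>" k] \<theta> by auto
      have "1 \<le> N * r k powr (- \<theta>) * D k"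
        using KL' k K(1) near by simp
      \<comment> \<open>Multiplying by a factor that is at least 1 creates the product
        \<open>dist (x (Suc k)) (x k) * D k\<close> that \<open>step\<close> controls.\<close>
      then have "\<kappa> * dist (x (Suc k)) (x k) * 1
          \<le> \<kappa> * dist (x (Suc k)) (x k) * (N * r k powr (- \<theta>) * D k)"
        using \<kappa> by (intro mult_left_mono) auto
      also have "\<dots> = N * r k powr (- \<theta>) * (\<kappa> * (dist (x (Suc k)) (x k) * D k))"
        by (simp add: mult_ac)
      also have "\<dots> \<le> N * r k powr (- \<theta>) * (r k - r (Suc k))"
        using step[of k] pos by (intro mult_left_mono) (auto simp: r_def)
      also have "\<dots> \<le> N * q * (r k - r (Suc k))"
        using q(1) decr[of k] pos by (intro mult_right_mono mult_left_mono) auto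
      finally have "dist (x (Suc k)) (x k) \<le> N / \<kappa> * (q * (r k - r (Suc k)))"
        using \<kappa> by (simp add: field_simps)
      also have "\<dots> = A * ((1 - \<theta>) * q * (r k - r (Suc k)))"
        using \<theta> by (simp add: A_def)
      also have "\<dots> = p k - p (Suc k)"
        unfolding p_def q(2)[symmetric] by (simp add: right_diff_distrib)
      finally show ?thesis .
    qed
    have p0: "0 \<le> p k" for k
      using A by (simp add: p_def)
    have start: "dist (x K) a + p K < \<delta>"
      using K K0[of K] by simp
    note near = finite_length_trapping(1)[OF pstep p0 start limpt]
      and bound = finite_length_trapping(2)[OF pstep p0 start limpt]
    \<comment> \<open>The constant results from squaring
      \<open>r k powr \<theta> \<le> N * D k\<close> and inserting it into
      \<open>desc\<close>.\<close>
    define c where "c = \<rho> / N\<^sup>2"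
    have c: "0 < c"
      using \<rho> pos by (simp add: c_def)
    have rdesc: "c * r k powr (2 * \<theta>) \<le> r k - r (Suc k)" if k: "K \<le> k" for k
    proof -
      have "r k powr \<theta> * 1 \<le> r k powr \<theta> * (N * r k powr (- \<theta>) * D k)"
        using KL'[of k] k K(1) near by (intro mult_left_mono) auto
      also have "\<dots> = N * D k * r k powr (\<theta> + - \<theta>)"
        unfolding powr_add by (simp add: mult_ac)
      also have "\<dots> = N * D k"
        using rpos[of k] by simp
      finally have "(r k powr \<theta>)\<^sup>2 \<le> (N * D k)\<^sup>2"
        by (intro power_mono) auto
      moreover have "(r k powr \<theta>)\<^sup>2 = r k powr (2 * \<theta>)"
        by (simp add: power2_eq_square powr_add[symmetric])
      ultimately have "c * r k powr (2 * \<theta>) \<le> c * (N * D k)\<^sup>2"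
        using c by simp
      also have "\<dots> = \<rho> * (D k)\<^sup>2"
        using pos by (simp add: c_def power_mult_distrib)
      finally show ?thesis
        using desc[of k] by (simp add: r_def)
    qed
    \<comment> \<open>With \<open>\<theta> = 0\<close> the gap \<open>r\<close> would lose at least
      \<open>c\<close> at every late step; hence finite convergence arises only in the other case,
      through some \<open>D k = 0\<close>.\<close>
    have "\<theta> \<noteq> 0"
    proof
      assume "\<theta> = 0"
      then have "c \<le> r k - r (Suc k)" if "K \<le> k" for k
        using rdesc[OF that] rpos[of k] by simp
      then show False
        by (rule powr_descent_theta_zero[OF rlim c])
    qed
    moreover have "\<exists>C>0. \<exists>q. 0 < q \<and> q < 1 \<and>
        (\<forall>\<^sub>F k in sequentially. norm (x k - a) \<le> C * q ^ k)" if half: "\<theta> \<le> 1 / 2"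
    proof -
      obtain C q where C: "0 < C" "0 < q" "q < 1" "\<forall>\<^sub>F k in sequentially. r k \<le> C * q ^ k"
        using powr_descent_linear[where r = r, OF rpos rlim c half rdesc] by blast
      have "\<forall>\<^sub>F k in sequentially.
          norm (x k - a) \<le> A * C powr (1 - \<theta>) * (q powr (1 - \<theta>)) ^ k"
        using C(4) eventually_ge_at_top[of K]
      proof eventually_elim
        case (elim k)
        have "r k powr (1 - \<theta>) \<le> (C * q ^ k) powr (1 - \<theta>)"
          using elim(1) rpos[of k] \<theta> by (intro powr_mono2) auto
        also have "\<dots> = C powr (1 - \<theta>) * (q powr (1 - \<theta>)) ^ k"
          using C by (simp add: powr_mult powr_powr powr_realpow[symmetric] mult.commute)
        finally have "p k \<le> A * (C powr (1 - \<theta>) * (q powr (1 - \<theta>)) ^ k)"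
          unfolding p_def using A by (intro mult_left_mono) auto
        then show ?case
          using bound[OF _ _ elim(2)] by (simp add: dist_norm mult.assoc)
      qed
      moreover have "q powr (1 - \<theta>) < 1"
        using C \<theta> powr_less_mono2[of "1 - \<theta>" q 1] by simp
      ultimately show ?thesis
        using A C by (intro exI[of _ "A * C powr (1 - \<theta>)"] conjI exI[of _ "q powr (1 - \<theta>)"]) auto
    qed
    moreover have "\<exists>C>0. \<forall>\<^sub>F k in sequentially.
        norm (x k - a) \<le> C * real k powr (- ((1 - \<theta>) / (2 * \<theta> - 1)))" if half: "1 / 2 < \<theta>"
    proof -
      obtain C where C: "0 < C" "\<forall>\<^sub>F k in sequentially. r k \<le> C * real k powr (- 1 / (2 * \<theta> - 1))"
        using powr_descent_sublinear[where r = r, OF rpos c half rdesc] by blast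
      have "\<forall>\<^sub>F k in sequentially. norm (x k - a)
          \<le> A * C powr (1 - \<theta>) * real k powr (- ((1 - \<theta>) / (2 * \<theta> - 1)))"
        using C(2) eventually_ge_at_top[of K]
      proof eventually_elim
        case (elim k)
        have "r k powr (1 - \<theta>) \<le> (C * real k powr (- 1 / (2 * \<theta> - 1))) powr (1 - \<theta>)"
          using elim(1) rpos[of k] \<theta> by (intro powr_mono2) auto
        also have "\<dots> = C powr (1 - \<theta>) * real k powr (- 1 / (2 * \<theta> - 1) * (1 - \<theta>))"
          by (simp only: powr_mult powr_powr)
        also have "- 1 / (2 * \<theta> - 1) * (1 - \<theta>) = - ((1 - \<theta>) / (2 * \<theta> - 1))"
          by simp
        finally have "p k \<le> A * (C powr (1 - \<theta>) * real k powr (- ((1 - \<theta>) / (2 * \<theta> - 1))))"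
          unfolding p_def using A by (intro mult_left_mono) auto
        then show ?case
          using bound[OF _ _ elim(2)] by (simp add: dist_norm mult.assoc)
      qed
      then show ?thesis
        using A C by (intro exI[of _ "A * C powr (1 - \<theta>)"] conjI) auto
    qed
    ultimately show ?thesis
      by blast
  qed
  then show "\<theta> = 0 \<Longrightarrow> \<forall>\<^sub>F k in sequentially. x k = a"
    and "0 < \<theta> \<Longrightarrow> \<theta> \<le> 1 / 2 \<Longrightarrow> \<exists>C>0. \<exists>q. 0 < q \<and> q < 1 \<and>
           (\<forall>\<^sub>F k in sequentially. norm (x k - a) \<le> C * q ^ k)"
    and "1 / 2 < \<theta> \<Longrightarrow> \<exists>C>0. \<forall>\<^sub>F k in sequentially.
           norm (x k - a) \<le> C * real k powr (- ((1 - \<theta>) / (2 * \<theta> - 1)))"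
    by blast+
qed

section \<open>The boosted DC algorithm\<close>

text \<open>In \<open>ereal\<close> a difference with an infinite argument is infinite,
  \<open>\<infinity> - \<infinity>\<close> included.\<close>

lemma dc_objective_finiteD:
  assumes "\<bar>dc_objective g h z\<bar> \<noteq> \<infinity>"
  shows "g z = ereal (real_of_ereal (g z))" and "h z = ereal (real_of_ereal (h z))"
  using assms by (cases "g z"; cases "h z"; simp add: dc_objective_def)+

lemma econvex_ereal_imp_convex_on:
  fixes f :: "'a::real_vector \<Rightarrow> real"
  shows "econvex (\<lambda>z. ereal (f z)) \<Longrightarrow> convex_on UNIV f"
  unfolding econvex_def by (intro convex_onI) auto

lemma strongly_econvex_ereal_imp_convex_on:
  fixes f :: "'a::real_normed_vector \<Rightarrow> real"
  shows "strongly_econvex \<rho> (\<lambda>z. ereal (f z)) \<Longrightarrow>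
    convex_on UNIV (\<lambda>z. f z - \<rho> / 2 * (norm z)\<^sup>2)"
  unfolding strongly_econvex_def by (intro econvex_ereal_imp_convex_on) simp

lemma subdifferential_ereal: "subdifferential (\<lambda>z. ereal (f z)) a = subgradients f a"
  by (auto simp: subdifferential_def subgradients_def edom_def le_diff_eq add.commute)

text \<open>Optimality of \<open>y\<close> in the subproblem is the subgradient inequality for
  \<open>G\<close> at \<open>y\<close>, and the exit condition of the backtracking loop is the
  decrease in the last claim.\<close>

lemma bdca_step_ereal:
  fixes G H :: "'a::euclidean_space \<Rightarrow> real"
  assumes step: "bdca_step (\<lambda>z. ereal (G z)) (\<lambda>z. ereal (H z)) \<alpha> \<beta> x u y lb l x'"
    and \<beta>: "0 < \<beta>"
  shows "u \<in> subgradients H x" and "u \<in> subgradients G y"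
    and "y = x \<Longrightarrow> x' = x"
    and "y \<noteq> x \<Longrightarrow> 0 \<le> l \<and> x' = y + l *\<^sub>R (y - x) \<and>
      G x' - H x' \<le> G y - H y - \<alpha> * l\<^sup>2 * (norm (y - x))\<^sup>2"
proof -
  show "u \<in> subgradients H x" "y = x \<Longrightarrow> x' = x"
    using step by (auto simp: bdca_step_def subdifferential_ereal)
  show "u \<in> subgradients G y"
    using step by (auto simp: bdca_step_def is_arg_min_def subgradients_def inner_diff_right not_less
        algebra_simps)
  assume "y \<noteq> x"
  then have lb: "0 \<le> lb" and x': "x' = y + l *\<^sub>R (y - x)"
    and loop: "while_option (\<lambda>t. dc_objective (\<lambda>z. ereal (G z)) (\<lambda>z. ereal (H z)) (y + t *\<^sub>R (y - x))
          > dc_objective (\<lambda>z. ereal (G z)) (\<lambda>z. ereal (H z)) y - ereal (\<alpha> * t\<^sup>2 * (norm (y - x))\<^sup>2))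
        (\<lambda>t. \<beta> * t) lb = Some l"
    using step by (auto simp: bdca_step_def Let_def)
  have "0 \<le> l"
    by (rule while_option_rule[OF _ loop, where P = "\<lambda>t. 0 \<le> t"]) (use \<beta> lb in auto)
  then show "0 \<le> l \<and> x' = y + l *\<^sub>R (y - x) \<and>
      G x' - H x' \<le> G y - H y - \<alpha> * l\<^sup>2 * (norm (y - x))\<^sup>2"
    using while_option_stop[OF loop] x' by (simp add: dc_objective_def)
qed

lemma bdca_descent:
  fixes G H :: "'a::euclidean_space \<Rightarrow> real"
  assumes convG: "convex_on UNIV (\<lambda>z. G z - \<rho> / 2 * (norm z)\<^sup>2)"
    and convH: "convex_on UNIV (\<lambda>z. H z - \<rho> / 2 * (norm z)\<^sup>2)"
    and step: "bdca_step (\<lambda>z. ereal (G z)) (\<lambda>z. ereal (H z)) \<alpha> \<beta> x u y lb l x'"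
    and pos: "0 < \<rho>" "0 < \<alpha>" "0 < \<beta>"
  shows "\<rho> * (norm (y - x))\<^sup>2 \<le> (G x - H x) - (G x' - H x')"
    and "min \<rho> \<alpha> / 2 * (dist x' x * norm (y - x)) \<le> (G x - H x) - (G x' - H x')"
proof -
  note s = bdca_step_ereal[OF step pos(3)]
  let ?d = "norm (y - x)"
  \<comment> \<open>The two strong subgradient inequalities share \<open>u\<close>, so their inner
    products cancel and \<open>\<rho> / 2\<close> is gained twice.\<close>
  have base: "\<rho> * ?d\<^sup>2 \<le> (G x - H x) - (G y - H y)"
    using subgradient_strong[OF convG s(2), of x] subgradient_strong[OF convH s(1), of y]
    by (simp add: norm_minus_commute inner_diff_right)
  have "\<rho> * ?d\<^sup>2 \<le> (G x - H x) - (G x' - H x') \<and>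
      min \<rho> \<alpha> / 2 * (dist x' x * ?d) \<le> (G x - H x) - (G x' - H x')"
  proof (cases "y = x")
    case True
    then show ?thesis
      using s(3) by simp
  next
    case False
    then have l: "0 \<le> l" and x': "x' = y + l *\<^sub>R (y - x)"
      and desc: "G x' - H x' \<le> G y - H y - \<alpha> * l\<^sup>2 * ?d\<^sup>2"
      using s(4) by auto
    have full: "(\<rho> + \<alpha> * l\<^sup>2) * ?d\<^sup>2 \<le> (G x - H x) - (G x' - H x')"
      using base desc by (simp add: algebra_simps)
    have "\<rho> * ?d\<^sup>2 \<le> (\<rho> + \<alpha> * l\<^sup>2) * ?d\<^sup>2"
      using pos by (intro mult_right_mono) auto
    moreover have "min \<rho> \<alpha> / 2 * (dist x' x * ?d) \<le> (\<rho> + \<alpha> * l\<^sup>2) * ?d\<^sup>2"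
    proof -
      have "x' - x = (1 + l) *\<^sub>R (y - x)"
        by (simp add: x' algebra_simps)
      then have "dist x' x = (1 + l) * ?d"
        using l by (simp add: dist_norm)
      then have "min \<rho> \<alpha> / 2 * (dist x' x * ?d) = min \<rho> \<alpha> * ((1 + l) / 2) * ?d\<^sup>2"
        by (simp add: power2_eq_square)
      \<comment> \<open>This compares the step length \<open>(1 + l) * ?d\<close> with the decrease
        and is the origin of the factor 1/2 in the constant.\<close>
      also have "(1 + l) / 2 \<le> 1 + l\<^sup>2"
      proof -
        have "2 * l \<le> 1 + l\<^sup>2"
          using zero_le_power2[of "l - 1"] by (simp add: power2_diff)
        then show ?thesis
          using l zero_le_power2[of l] by argo
      qed
      then have "min \<rho> \<alpha> * ((1 + l) / 2) * ?d\<^sup>2 \<le> min \<rho> \<alpha> * (1 + l\<^sup>2) * ?d\<^sup>2"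
        using pos by (intro mult_right_mono mult_left_mono) auto
      also have "min \<rho> \<alpha> * (1 + l\<^sup>2) \<le> \<rho> + \<alpha> * l\<^sup>2"
        using mult_right_mono[of "min \<rho> \<alpha>" \<alpha> "l\<^sup>2"] by (simp add: distrib_left)
      then have "min \<rho> \<alpha> * (1 + l\<^sup>2) * ?d\<^sup>2 \<le> (\<rho> + \<alpha> * l\<^sup>2) * ?d\<^sup>2"
        by (intro mult_right_mono) auto
      finally show ?thesis .
    qed
    ultimately show ?thesis
      using full by linarith
  qed
  then show "\<rho> * ?d\<^sup>2 \<le> (G x - H x) - (G x' - H x')"
    and "min \<rho> \<alpha> / 2 * (dist x' x * ?d) \<le> (G x - H x) - (G x' - H x')"
    by auto
qed

text \<open>Since \<open>u = gradient G y\<close>, Lipschitz continuity bounds the Clarke slope at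
  \<open>x\<close> by a multiple of \<open>norm (y - x)\<close>, turning the inequality for slopes
  into one for the DC direction.\<close>

lemma KL_powr_gradient_bound:
  fixes G H :: "'a::euclidean_space \<Rightarrow> real"
  assumes KL: "strong_KL_with (\<lambda>t. M * t powr (1 - \<theta>)) (\<lambda>z. G z - H z) a"
    and lip: "lipschitz_around (gradient G) a" and M: "0 < M" and \<theta>: "\<theta> < 1"
    and G: "\<And>z. G differentiable (at z)" and contG: "continuous_on UNIV (gradient G)"
    and contH: "continuous_on UNIV H" and sub: "\<And>z. subgradients H z \<noteq> {}"
  obtains \<delta> \<eta> N where "0 < \<delta>" "0 < \<eta>" "0 < N"
    "\<And>x y u. dist x a < \<delta> \<Longrightarrow> dist y x < \<delta> \<Longrightarrow> G a - H a < G x - H x \<Longrightarrow>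
       G x - H x < G a - H a + \<eta> \<Longrightarrow> u \<in> subgradients H x \<Longrightarrow> u \<in> subgradients G y \<Longrightarrow>
       1 \<le> N * ((G x - H x) - (G a - H a)) powr (- \<theta>) * norm (y - x)"
proof -
  obtain \<eta> U where \<eta>: "0 < \<eta>" and U: "open U" "a \<in> U"
    and KLU: "\<forall>x\<in>U. G a - H a < G x - H x \<and> G x - H x < G a - H a + \<eta> \<longrightarrow>
      1 \<le> deriv (\<lambda>t. M * t powr (1 - \<theta>)) (G x - H x - (G a - H a))
        * infdist 0 (clarke_subdifferential (\<lambda>z. G z - H z) x)"
    using KL unfolding strong_KL_with_def by blast
  obtain V L where V: "open V" "a \<in> V" and L: "L-lipschitz_on V (gradient G)"
    using lip unfolding lipschitz_around_def by blast
  have "open (U \<inter> V)" "a \<in> U \<inter> V"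
    using U V by auto
  then obtain \<epsilon> where \<epsilon>: "0 < \<epsilon>" "ball a \<epsilon> \<subseteq> U \<inter> V"
    using open_contains_ball by metis
  \<comment> \<open>\<open>M * (1 - \<theta>)\<close> stems from the derivative of
    \<open>M * t powr (1 - \<theta>)\<close>; \<open>L + 1\<close> replaces \<open>L\<close> to stay
    positive when \<open>L = 0\<close>.\<close>
  define N where "N = M * (1 - \<theta>) * (L + 1)"
  have L0: "0 \<le> L"
    using L by (rule lipschitz_on_nonneg)
  have N: "0 < N"
    using M \<theta> L0 by (simp add: N_def)
  have "1 \<le> N * ((G x - H x) - (G a - H a)) powr (- \<theta>) * norm (y - x)"
    if near: "dist x a < \<epsilon> / 2" "dist y x < \<epsilon> / 2"
      and val: "G a - H a < G x - H x" "G x - H x < G a - H a + \<eta>"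
      and u: "u \<in> subgradients H x" "u \<in> subgradients G y" for x y u
  proof -
    define r where "r = G x - H x - (G a - H a)"
    have r: "0 < r"
      using val by (simp add: r_def)
    have xin: "x \<in> ball a \<epsilon>" and yin: "y \<in> ball a \<epsilon>"
      using near dist_triangle[of y a x] \<epsilon>(1) by (auto simp: dist_commute)
    have "infdist 0 (clarke_subdifferential (\<lambda>z. G z - H z) x) \<le> norm (gradient G x - u)"
      using contG by (intro infdist_clarke_le G contH sub u(1)) (simp add: continuous_on_eq_continuous_at)
    also have "u = gradient G y"
      by (rule subgradient_eq_gradient[OF u(2) differentiable_imp_GDERIV[OF G]])
    also have "norm (gradient G x - gradient G y) \<le> L * norm (y - x)"
    proof -
      have "x \<in> V" "y \<in> V"
        using xin yin \<epsilon>(2) by auto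
      then show ?thesis
        using lipschitz_onD[OF L, of x y] by (simp add: dist_norm norm_minus_commute)
    qed
    also have "\<dots> \<le> (L + 1) * norm (y - x)"
      by (intro mult_right_mono) auto
    finally have inf: "infdist 0 (clarke_subdifferential (\<lambda>z. G z - H z) x) \<le> (L + 1) * norm (y - x)" .
    have "((\<lambda>t. M * t powr (1 - \<theta>)) has_real_derivative M * (1 - \<theta>) * r powr (- \<theta>)) (at r)"
      using r by (auto intro!: derivative_eq_intros)
    then have deriv: "deriv (\<lambda>t. M * t powr (1 - \<theta>)) r = M * (1 - \<theta>) * r powr (- \<theta>)"
      by (rule DERIV_imp_deriv)
    have "x \<in> U"
      using xin \<epsilon>(2) by auto
    with KLU val have "1 \<le> deriv (\<lambda>t. M * t powr (1 - \<theta>)) r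
        * infdist 0 (clarke_subdifferential (\<lambda>z. G z - H z) x)"
      unfolding r_def by blast
    then have "1 \<le> M * (1 - \<theta>) * r powr (- \<theta>)
        * infdist 0 (clarke_subdifferential (\<lambda>z. G z - H z) x)"
      unfolding deriv .
    also have "\<dots> \<le> M * (1 - \<theta>) * r powr (- \<theta>) * ((L + 1) * norm (y - x))"
      using inf M \<theta> by (intro mult_left_mono) auto
    finally show ?thesis
      by (simp add: N_def r_def mult_ac)
  qed
  then show ?thesis
    using that[of "\<epsilon> / 2" \<eta> N] \<epsilon>(1) \<eta> N by auto
qed

theorem theorem4p2:
  fixes g h :: "real ^ 'm \<Rightarrow> ereal"
    and x :: "nat \<Rightarrow> real ^ 'm" and xs :: "real ^ 'm"
    and \<rho> \<alpha> \<beta> M \<theta> :: real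
  assumes "proper g" and "econvex g" and "proper h" and "econvex h"
    and "\<rho> > 0" and "strongly_econvex \<rho> g" and "strongly_econvex \<rho> h"
    and "\<And>z. z \<in> edom h \<Longrightarrow> subdifferential h z \<noteq> {}"
    and "\<exists>S. open S \<and> edom h \<subseteq> S \<and> finite_C1_on g S"
    and "(INF z. dc_objective g h z) > -\<infinity>"
    and "\<alpha> > 0" and "0 < \<beta>" and "\<beta> < 1"
    and "bdca_sequence g h \<alpha> \<beta> x"
    and "\<exists>r :: nat \<Rightarrow> nat. strict_mono r \<and> (x \<circ> r) \<longlonglongrightarrow> xs"
    and "lipschitz_around (gradient (\<lambda>z. real_of_ereal (g z))) xs"
    and "\<And>z. \<bar>dc_objective g h z\<bar> \<noteq> \<infinity>"
    and "M > 0" and "0 \<le> \<theta>" and "\<theta> < 1"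
    and "strong_KL_with (\<lambda>t. M * t powr (1 - \<theta>))
           (\<lambda>z. real_of_ereal (dc_objective g h z)) xs"
  shows "(\<theta> = 0 \<longrightarrow> (\<forall>\<^sub>F k in sequentially. x k = xs)) \<and>
         (0 < \<theta> \<and> \<theta> \<le> 1/2 \<longrightarrow>
            (\<exists>C>0. \<exists>q. 0 < q \<and> q < 1 \<and>
               (\<forall>\<^sub>F k in sequentially. norm (x k - xs) \<le> C * q ^ k))) \<and>
         (1/2 < \<theta> \<and> \<theta> < 1 \<longrightarrow>
            (\<exists>\<eta>>0. \<forall>\<^sub>F k in sequentially.
               norm (x k - xs) \<le> \<eta> * real k powr (- ((1 - \<theta>) / (2 * \<theta> - 1)))))"
proof -
  define G where "G z = real_of_ereal (g z)" for z
  define H where "H z = real_of_ereal (h z)" for z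
  define f where "f z = G z - H z" for z
  have g: "g = (\<lambda>z. ereal (G z))" and h: "h = (\<lambda>z. ereal (H z))"
    using dc_objective_finiteD[OF assms(17)] by (auto simp: G_def H_def)
  \<comment> \<open>Hence the smoothness of \<open>g\<close> and the existence of subgradients of
    \<open>h\<close> hold at every point.\<close>
  have dom: "edom h = UNIV"
    by (auto simp: h edom_def)
  have f: "(\<lambda>z. real_of_ereal (dc_objective g h z)) = (\<lambda>z. G z - H z)"
    by (simp add: dc_objective_def g h)
  have convG: "convex_on UNIV (\<lambda>z. G z - \<rho> / 2 * (norm z)\<^sup>2)"
    using assms(6) unfolding g by (rule strongly_econvex_ereal_imp_convex_on)
  have convH: "convex_on UNIV (\<lambda>z. H z - \<rho> / 2 * (norm z)\<^sup>2)"
    using assms(7) unfolding h by (rule strongly_econvex_ereal_imp_convex_on)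
  have contG: "continuous_on UNIV G"
    using econvex_ereal_imp_convex_on[of G] assms(2) unfolding g
    by (intro convex_on_continuous) auto
  have contH: "continuous_on UNIV H"
    using econvex_ereal_imp_convex_on[of H] assms(4) unfolding h
    by (intro convex_on_continuous) auto
  have sub: "subgradients H z \<noteq> {}" for z
    using assms(8)[of z] dom unfolding h subdifferential_ereal by simp
  have diffG: "G differentiable (at z)" for z
    using assms(9) dom unfolding finite_C1_on_def G_def by (metis UNIV_I subsetD)
  have gradG: "continuous_on UNIV (gradient G)"
    using assms(9) dom unfolding finite_C1_on_def G_def[abs_def] by (metis continuous_on_subset)
  obtain \<delta> \<eta> N where pos: "0 < \<delta>" "0 < \<eta>" "0 < N" and KL:
    "\<And>x y u. dist x xs < \<delta> \<Longrightarrow> dist y x < \<delta> \<Longrightarrow> G xs - H xs < G x - H x \<Longrightarrow>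
       G x - H x < G xs - H xs + \<eta> \<Longrightarrow> u \<in> subgradients H x \<Longrightarrow> u \<in> subgradients G y \<Longrightarrow>
       1 \<le> N * ((G x - H x) - (G xs - H xs)) powr (- \<theta>) * norm (y - x)"
    using KL_powr_gradient_bound[OF assms(21)[unfolded f] assms(16)[folded G_def[abs_def]]
        \<open>M > 0\<close> \<open>\<theta> < 1\<close> diffG gradG contH sub] by blast
  obtain u y lb l where run: "\<And>k. if \<exists>j<k. y j = x j then x (Suc k) = x k
      else bdca_step g h \<alpha> \<beta> (x k) (u k) (y k) (lb k) (l k) (x (Suc k))"
    using assms(14) unfolding bdca_sequence_def by blast
  obtain s :: "nat \<Rightarrow> nat" where s: "strict_mono s" "(x \<circ> s) \<longlonglongrightarrow> xs"
    using assms(15) by blast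
  \<comment> \<open>After a stop the values \<open>y k\<close> are unconstrained, so
    \<open>D k\<close> is set to 0 there.\<close>
  define D where "D k = (if \<exists>j<k. y j = x j then 0 else norm (y k - x k))" for k
  have stopped: "x (Suc k) = x k" if "\<exists>j<k. y j = x j" for k
    using run[of k] that by simp
  have step: "bdca_step (\<lambda>z. ereal (G z)) (\<lambda>z. ereal (H z)) \<alpha> \<beta>
      (x k) (u k) (y k) (lb k) (l k) (x (Suc k))" if "\<not> (\<exists>j<k. y j = x j)" for k
    using run[of k] that unfolding g h by simp
  have cont: "isCont f xs"
    using contG contH unfolding f_def by (intro continuous_diff) (auto simp: continuous_on_eq_continuous_at)
  have \<kappa>: "0 < min \<rho> \<alpha> / 2"
    using assms(5,11) by simp
  have D0: "0 \<le> D k" for k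
    by (simp add: D_def)
  have move: "min \<rho> \<alpha> / 2 * (dist (x (Suc k)) (x k) * D k) \<le> f (x k) - f (x (Suc k))" for k
    using bdca_descent(2)[OF convG convH step assms(5,11,12)] stopped
    by (simp add: D_def f_def)
  have desc: "\<rho> * (D k)\<^sup>2 \<le> f (x k) - f (x (Suc k))" for k
    using bdca_descent(1)[OF convG convH step assms(5,11,12)] stopped
    by (simp add: D_def f_def)
  have const: "x j = x k" if "D k = 0" "k \<le> j" for k j
  proof -
    have "\<exists>i\<le>k. y i = x i"
      using that(1) by (auto simp: D_def split: if_splits intro: less_imp_le)
    then obtain i where i: "i \<le> k" "y i = x i"
      by blast
    have Suc: "x (Suc n) = x n" if "k \<le> n" for n
    proof (cases "\<exists>j<n. y j = x j")
      case True
      then show ?thesis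
        by (rule stopped)
    next
      \<comment> \<open>No stop before \<open>n\<close>, together with \<open>i \<le> k\<close> and
        \<open>k \<le> n\<close>, forces \<open>i = n\<close>: the stop happens at this very
        step.\<close>
      case False
      then have "y n = x n"
        using i that by (metis le_neq_implies_less order_trans)
      then show ?thesis
        using bdca_step_ereal(3)[OF step[OF False] assms(12)] by simp
    qed
    show ?thesis
      using that(2) by (induction j rule: dec_induct) (auto simp: Suc)
  qed
  have KL': "1 \<le> N * (f (x k) - f xs) powr (- \<theta>) * D k"
    if "dist (x k) xs < \<delta>" "0 < D k" "D k < \<delta>" "f xs < f (x k)" "f (x k) < f xs + \<eta>" for k
  proof -
    have run_k: "\<not> (\<exists>j<k. y j = x j)" and Dk: "D k = norm (y k - x k)"
      using that(2) by (auto simp: D_def split: if_splits)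
    show ?thesis
      using KL[of "x k" "y k" "u k"] bdca_step_ereal(1,2)[OF step[OF run_k] assms(12)] that Dk
      by (simp add: f_def dist_norm)
  qed
  note rates = kl_descent_rates[where f = f and x = x and D = D,
      OF cont \<kappa> \<open>\<rho> > 0\<close> D0 move desc const s \<open>0 \<le> \<theta>\<close> \<open>\<theta> < 1\<close> pos KL']
  show ?thesis
    using rates(1) rates(2) rates(3) by blast
qed

end
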